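(* Let $\mathbf B$ and $\mathbf C$ be integral residuated lattices with $B\cap C=F$, where $F$ is a congruence filter of $\mathbf C$ strictly above all other elements of $C$, and $F$ is also a congruence filter of $\mathbf B$ compatible with $\mathbf B$; assume moreover that if some $x,y\in B\setminus F$ satisfy $x\vee y\in F$ in $\mathbf B$, then $\mathbf C$ has a least element $0_C$. Define $\mathbf B\oplus_F\mathbf C$ on $B\cup C$ by: operations on pairs from $B$ or pairs from $C$ as in $\mathbf B$, resp. $\mathbf C$ (except that for $x,y\in B\setminus F$ with $x\vee y\in F$ we set $x\vee y=0_C$); and for $x\in B\setminus F$, $c\in C\setminus F$: $xc=cx=\sigma_F(x)$, $c\backslash x=x/c=\gamma_F(x)$, $x\backslash c=c/x=1$, $x\wedge c=c\wedge x=x$, $x\vee c=c\vee x=c$. Then $\mathbf B\oplus_F\mathbf C$ is an integral residuated lattice and it is the gluing of $\mathbf B$ and $\mathbf C$ over $F$.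
   Context: An IRL is a residuated lattice ($xy\le z\iff y\le x\backslash z\iff x\le z/y$) whose monoid unit $1$ is the top. A congruence filter of an IRL is a nonempty upset closed under products and conjugates ($x\in F\Rightarrow yx/y,\ y\backslash xy\in F$); $[x]_F$ is the class of $x$ under $\theta_F=\{(x,y): x\backslash y,y\backslash x\in F\}$. $F$ is compatible with $\mathbf B$ if: every element of $F$ is strictly above every element of $B\setminus F$; for each $b\in B\setminus F$, $[b]_F$ has a minimum $\sigma_F(b)$ and a maximum $\gamma_F(b)$; and for all $b\in B\setminus F$, $b\,\sigma_F[B\setminus F]\subseteq\sigma_F[B\setminus F]$ and $\sigma_F[B\setminus F]\,b\subseteq\sigma_F[B\setminus F]$. Given IRLs $\mathbf B,\mathbf C$, a gluing of $\mathbf B$ and $\mathbf C$ over $F$ is an IRL $\mathbf D$ with universe $B\cup C$ such that $F=B\cap C$ is a congruence filter of $\mathbf D$, $b<c<f$ for all $b\in B\setminus F$, $c\in C\setminus F$, $f\in F$, $C$ is a subalgebra of $\mathbf D$, and $B$ is a subalgebra except possibly with respect to $\vee$ (in which case $F$ has a bottom element). *)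

theory Defs
  imports "HOL-Algebra.Group"
begin

(* The divisions are  ldiv A x z = x \ z  and  rdiv A z y = z / y. *)
record 'a reslat = "'a monoid" +
  rl_meet :: "'a \<Rightarrow> 'a \<Rightarrow> 'a"
  rl_join :: "'a \<Rightarrow> 'a \<Rightarrow> 'a"
  ldiv :: "'a \<Rightarrow> 'a \<Rightarrow> 'a"
  rdiv :: "'a \<Rightarrow> 'a \<Rightarrow> 'a"

definition rl_le :: "'a reslat \<Rightarrow> 'a \<Rightarrow> 'a \<Rightarrow> bool" where
  "rl_le A x y \<longleftrightarrow> rl_meet A x y = x"

definition rl_less :: "'a reslat \<Rightarrow> 'a \<Rightarrow> 'a \<Rightarrow> bool" where
  "rl_less A x y \<longleftrightarrow> rl_le A x y \<and> x \<noteq> y"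

locale integral_residuated_lattice = monoid A for A :: "'a reslat" (structure) +
  assumes meet_closed: "\<lbrakk>x \<in> carrier A; y \<in> carrier A\<rbrakk> \<Longrightarrow> rl_meet A x y \<in> carrier A"
    and join_closed: "\<lbrakk>x \<in> carrier A; y \<in> carrier A\<rbrakk> \<Longrightarrow> rl_join A x y \<in> carrier A"
    and ldiv_closed: "\<lbrakk>x \<in> carrier A; y \<in> carrier A\<rbrakk> \<Longrightarrow> ldiv A x y \<in> carrier A"
    and rdiv_closed: "\<lbrakk>x \<in> carrier A; y \<in> carrier A\<rbrakk> \<Longrightarrow> rdiv A x y \<in> carrier A"
    and meet_commute: "\<lbrakk>x \<in> carrier A; y \<in> carrier A\<rbrakk> \<Longrightarrow> rl_meet A x y = rl_meet A y x"
    and join_commute: "\<lbrakk>x \<in> carrier A; y \<in> carrier A\<rbrakk> \<Longrightarrow> rl_join A x y = rl_join A y x"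
    and meet_assoc: "\<lbrakk>x \<in> carrier A; y \<in> carrier A; z \<in> carrier A\<rbrakk>
      \<Longrightarrow> rl_meet A (rl_meet A x y) z = rl_meet A x (rl_meet A y z)"
    and join_assoc: "\<lbrakk>x \<in> carrier A; y \<in> carrier A; z \<in> carrier A\<rbrakk>
      \<Longrightarrow> rl_join A (rl_join A x y) z = rl_join A x (rl_join A y z)"
    and meet_join_absorb: "\<lbrakk>x \<in> carrier A; y \<in> carrier A\<rbrakk> \<Longrightarrow> rl_meet A x (rl_join A x y) = x"
    and join_meet_absorb: "\<lbrakk>x \<in> carrier A; y \<in> carrier A\<rbrakk> \<Longrightarrow> rl_join A x (rl_meet A x y) = x"
    and residuation_left: "\<lbrakk>x \<in> carrier A; y \<in> carrier A; z \<in> carrier A\<rbrakk>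
      \<Longrightarrow> rl_le A (x \<otimes> y) z \<longleftrightarrow> rl_le A y (ldiv A x z)"
    and residuation_right: "\<lbrakk>x \<in> carrier A; y \<in> carrier A; z \<in> carrier A\<rbrakk>
      \<Longrightarrow> rl_le A (x \<otimes> y) z \<longleftrightarrow> rl_le A x (rdiv A z y)"
    and one_top: "x \<in> carrier A \<Longrightarrow> rl_le A x \<one>"

definition is_min :: "'a reslat \<Rightarrow> 'a set \<Rightarrow> 'a \<Rightarrow> bool" where
  "is_min A S m \<longleftrightarrow> m \<in> S \<and> (\<forall>s\<in>S. rl_le A m s)"

definition is_max :: "'a reslat \<Rightarrow> 'a set \<Rightarrow> 'a \<Rightarrow> bool" where
  "is_max A S m \<longleftrightarrow> m \<in> S \<and> (\<forall>s\<in>S. rl_le A s m)"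

definition congruence_filter :: "'a reslat \<Rightarrow> 'a set \<Rightarrow> bool" where
  "congruence_filter A F \<longleftrightarrow>
     F \<noteq> {} \<and> F \<subseteq> carrier A \<and>
     (\<forall>x\<in>F. \<forall>y\<in>carrier A. rl_le A x y \<longrightarrow> y \<in> F) \<and>
     (\<forall>x\<in>F. \<forall>y\<in>F. x \<otimes>\<^bsub>A\<^esub> y \<in> F) \<and>
     (\<forall>x\<in>F. \<forall>y\<in>carrier A.
        rdiv A (y \<otimes>\<^bsub>A\<^esub> x) y \<in> F \<and> ldiv A y (x \<otimes>\<^bsub>A\<^esub> y) \<in> F)"

definition filter_cong :: "'a reslat \<Rightarrow> 'a set \<Rightarrow> ('a \<times> 'a) set" where
  "filter_cong A F =
     {(x, y). x \<in> carrier A \<and> y \<in> carrier A \<and> ldiv A x y \<in> F \<and> ldiv A y x \<in> F}"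

definition filter_class :: "'a reslat \<Rightarrow> 'a set \<Rightarrow> 'a \<Rightarrow> 'a set" where
  "filter_class A F x = filter_cong A F `` {x}"

(* Meaningful only where the class has a minimum, resp. a maximum. *)
definition sigma :: "'a reslat \<Rightarrow> 'a set \<Rightarrow> 'a \<Rightarrow> 'a" where
  "sigma A F x = (THE m. is_min A (filter_class A F x) m)"

definition gamma :: "'a reslat \<Rightarrow> 'a set \<Rightarrow> 'a \<Rightarrow> 'a" where
  "gamma A F x = (THE m. is_max A (filter_class A F x) m)"

(* Meaningful only if A has a least element. *)
definition bottom_elem :: "'a reslat \<Rightarrow> 'a" where
  "bottom_elem A = (THE m. is_min A (carrier A) m)"

definition compatible :: "'a reslat \<Rightarrow> 'a set \<Rightarrow> bool" where
  "compatible A F \<longleftrightarrow>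
     (\<forall>f\<in>F. \<forall>b\<in>carrier A - F. rl_less A b f) \<and>
     (\<forall>b\<in>carrier A - F.
        (\<exists>m. is_min A (filter_class A F b) m) \<and> (\<exists>m. is_max A (filter_class A F b) m)) \<and>
     (\<forall>b\<in>carrier A - F.
        (\<lambda>s. b \<otimes>\<^bsub>A\<^esub> s) ` sigma A F ` (carrier A - F) \<subseteq> sigma A F ` (carrier A - F) \<and>
        (\<lambda>s. s \<otimes>\<^bsub>A\<^esub> b) ` sigma A F ` (carrier A - F) \<subseteq> sigma A F ` (carrier A - F))"

definition agree_except_join_on :: "'a set \<Rightarrow> 'a reslat \<Rightarrow> 'a reslat \<Rightarrow> bool" where
  "agree_except_join_on S A A' \<longleftrightarrow>
     \<one>\<^bsub>A\<^esub> = \<one>\<^bsub>A'\<^esub> \<and>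
     (\<forall>x\<in>S. \<forall>y\<in>S. x \<otimes>\<^bsub>A\<^esub> y = x \<otimes>\<^bsub>A'\<^esub> y \<and> rl_meet A x y = rl_meet A' x y \<and>
        ldiv A x y = ldiv A' x y \<and> rdiv A x y = rdiv A' x y)"

definition agree_join_on :: "'a set \<Rightarrow> 'a reslat \<Rightarrow> 'a reslat \<Rightarrow> bool" where
  "agree_join_on S A A' \<longleftrightarrow> (\<forall>x\<in>S. \<forall>y\<in>S. rl_join A x y = rl_join A' x y)"

definition agree_on :: "'a set \<Rightarrow> 'a reslat \<Rightarrow> 'a reslat \<Rightarrow> bool" where
  "agree_on S A A' \<longleftrightarrow> agree_except_join_on S A A' \<and> agree_join_on S A A'"

(* That carrier B and carrier C are closed under the operations of D follows from the
   agreement of the operations, since B and C are algebras themselves. *)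
definition is_gluing :: "'a reslat \<Rightarrow> 'a reslat \<Rightarrow> 'a set \<Rightarrow> 'a reslat \<Rightarrow> bool" where
  "is_gluing B C F D \<longleftrightarrow>
     integral_residuated_lattice D \<and>
     carrier D = carrier B \<union> carrier C \<and>
     F = carrier B \<inter> carrier C \<and>
     congruence_filter D F \<and>
     (\<forall>b\<in>carrier B - F. \<forall>c\<in>carrier C - F. \<forall>f\<in>F. rl_less D b c \<and> rl_less D c f) \<and>
     agree_on (carrier C) C D \<and>
     agree_except_join_on (carrier B) B D \<and>
     (agree_join_on (carrier B) B D \<or> (\<exists>m. is_min D F m))"

(* In each operation, once the cases of two arguments in B and of two arguments in C are
   excluded, one argument lies in B - F and the other in C - F, where F = B \<inter> C. *)
definition gluing_sum :: "'a reslat \<Rightarrow> 'a set \<Rightarrow> 'a reslat \<Rightarrow> 'a reslat" where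
  "gluing_sum B F C =
     \<lparr>carrier = carrier B \<union> carrier C,
      monoid.mult = (\<lambda>x y.
        if x \<in> carrier B \<and> y \<in> carrier B then x \<otimes>\<^bsub>B\<^esub> y
        else if x \<in> carrier C \<and> y \<in> carrier C then x \<otimes>\<^bsub>C\<^esub> y
        else if x \<in> carrier B then sigma B F x else sigma B F y),
      one = \<one>\<^bsub>B\<^esub>,
      rl_meet = (\<lambda>x y.
        if x \<in> carrier B \<and> y \<in> carrier B then rl_meet B x y
        else if x \<in> carrier C \<and> y \<in> carrier C then rl_meet C x y
        else if x \<in> carrier B then x else y),
      rl_join = (\<lambda>x y.
        if x \<in> carrier B - F \<and> y \<in> carrier B - F \<and> rl_join B x y \<in> F then bottom_elem C
        else if x \<in> carrier B \<and> y \<in> carrier B then rl_join B x y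
        else if x \<in> carrier C \<and> y \<in> carrier C then rl_join C x y
        else if x \<in> carrier B then y else x),
      ldiv = (\<lambda>x y.
        if x \<in> carrier B \<and> y \<in> carrier B then ldiv B x y
        else if x \<in> carrier C \<and> y \<in> carrier C then ldiv C x y
        else if x \<in> carrier B then \<one>\<^bsub>B\<^esub> else gamma B F y),
      rdiv = (\<lambda>x y.
        if x \<in> carrier B \<and> y \<in> carrier B then rdiv B x y
        else if x \<in> carrier C \<and> y \<in> carrier C then rdiv C x y
        else if x \<in> carrier B then gamma B F x else \<one>\<^bsub>B\<^esub>)\<rparr>"

end

theory Submission
  imports Defs
begin

text \<open>
  Write P, Q for the parts of B and C outside F, so that P lies below Q and Q below F.
  Everything rests on the Galois-type equivalence: for x, y in P,
  \<sigma>(x) \<le> y iff x \ y \<in> F iff y / x \<in> F iff x \<le> \<gamma>(y).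
  As an element of Q lies below an element of B exactly if the latter is in F, this is
  residuation in the mixed cases. Compatibility yields
  x \<sigma>(y) = \<sigma>(xy) = \<sigma>(x) y, which is what associativity needs.
  In an arbitrary gluing the product of b in P and c in Q is forced: for y in P, bc \<le> y iff
  c \<le> b \ y iff b \ y \<in> F iff \<sigma>(b) \<le> y. An integral residuated lattice is
  determined by its meet and its product, so the gluing is unique.
\<close>

section \<open>Integral residuated lattices as ordered structures\<close>

context integral_residuated_lattice
begin

lemma meet_idem: "x \<in> carrier A \<Longrightarrow> rl_meet A x x = x"
  by (metis join_closed join_meet_absorb meet_closed meet_join_absorb)

lemma le_refl: "x \<in> carrier A \<Longrightarrow> rl_le A x x"
  by (simp add: rl_le_def meet_idem)

lemma le_antisym: "\<lbrakk>rl_le A x y; rl_le A y x; x \<in> carrier A; y \<in> carrier A\<rbrakk> \<Longrightarrow> x = y"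
  by (metis meet_commute rl_le_def)

lemma le_trans:
  "\<lbrakk>rl_le A x y; rl_le A y z; x \<in> carrier A; y \<in> carrier A; z \<in> carrier A\<rbrakk> \<Longrightarrow> rl_le A x z"
  by (metis meet_assoc rl_le_def)

lemma meet_le1: "\<lbrakk>x \<in> carrier A; y \<in> carrier A\<rbrakk> \<Longrightarrow> rl_le A (rl_meet A x y) x"
  by (metis meet_assoc meet_commute meet_idem meet_closed rl_le_def)

lemma meet_le2: "\<lbrakk>x \<in> carrier A; y \<in> carrier A\<rbrakk> \<Longrightarrow> rl_le A (rl_meet A x y) y"
  by (metis meet_le1 meet_commute)

lemma meet_greatest:
  "\<lbrakk>rl_le A z x; rl_le A z y; x \<in> carrier A; y \<in> carrier A; z \<in> carrier A\<rbrakk>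
    \<Longrightarrow> rl_le A z (rl_meet A x y)"
  by (metis meet_assoc rl_le_def)

lemma join_ge1: "\<lbrakk>x \<in> carrier A; y \<in> carrier A\<rbrakk> \<Longrightarrow> rl_le A x (rl_join A x y)"
  by (simp add: rl_le_def meet_join_absorb)

lemma join_ge2: "\<lbrakk>x \<in> carrier A; y \<in> carrier A\<rbrakk> \<Longrightarrow> rl_le A y (rl_join A x y)"
  by (metis join_ge1 join_commute)

lemma le_iff_join: "\<lbrakk>x \<in> carrier A; y \<in> carrier A\<rbrakk> \<Longrightarrow> rl_le A x y \<longleftrightarrow> rl_join A x y = y"
  by (metis join_commute join_ge1 join_meet_absorb meet_commute rl_le_def)

lemma join_least:
  "\<lbrakk>rl_le A x z; rl_le A y z; x \<in> carrier A; y \<in> carrier A; z \<in> carrier A\<rbrakk>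
    \<Longrightarrow> rl_le A (rl_join A x y) z"
  by (metis join_assoc join_closed le_iff_join)

lemma mult_mono_right:
  assumes "rl_le A x y" "x \<in> carrier A" "y \<in> carrier A" "z \<in> carrier A"
  shows "rl_le A (z \<otimes> x) (z \<otimes> y)"
proof -
  have "rl_le A y (ldiv A z (z \<otimes> y))"
    using assms le_refl by (simp flip: residuation_left)
  then have "rl_le A x (ldiv A z (z \<otimes> y))"
    using assms le_trans ldiv_closed m_closed by blast
  then show ?thesis
    using assms by (simp add: residuation_left)
qed

lemma mult_mono_left:
  assumes "rl_le A x y" "x \<in> carrier A" "y \<in> carrier A" "z \<in> carrier A"
  shows "rl_le A (x \<otimes> z) (y \<otimes> z)"
proof -
  have "rl_le A y (rdiv A (y \<otimes> z) z)"
    using assms le_refl by (simp flip: residuation_right)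
  then have "rl_le A x (rdiv A (y \<otimes> z) z)"
    using assms le_trans rdiv_closed m_closed by blast
  then show ?thesis
    using assms by (simp add: residuation_right)
qed

lemma mult_le1: "\<lbrakk>x \<in> carrier A; y \<in> carrier A\<rbrakk> \<Longrightarrow> rl_le A (x \<otimes> y) x"
  by (metis mult_mono_right one_closed one_top r_one)

lemma mult_le2: "\<lbrakk>x \<in> carrier A; y \<in> carrier A\<rbrakk> \<Longrightarrow> rl_le A (x \<otimes> y) y"
  by (metis mult_mono_left one_closed one_top l_one)

lemma mult_ldiv_le: "\<lbrakk>x \<in> carrier A; y \<in> carrier A\<rbrakk> \<Longrightarrow> rl_le A (x \<otimes> ldiv A x y) y"
  by (simp add: residuation_left ldiv_closed le_refl)

lemma rdiv_mult_le: "\<lbrakk>x \<in> carrier A; y \<in> carrier A\<rbrakk> \<Longrightarrow> rl_le A (rdiv A y x \<otimes> x) y"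
  by (simp add: residuation_right rdiv_closed le_refl)

lemma le_rdiv: "\<lbrakk>x \<in> carrier A; y \<in> carrier A\<rbrakk> \<Longrightarrow> rl_le A y (rdiv A y x)"
  by (metis mult_le1 residuation_right)

lemma is_min_unique: "\<lbrakk>is_min A S m; is_min A S n; S \<subseteq> carrier A\<rbrakk> \<Longrightarrow> m = n"
  unfolding is_min_def by (meson le_antisym subsetD)

lemma is_max_unique: "\<lbrakk>is_max A S m; is_max A S n; S \<subseteq> carrier A\<rbrakk> \<Longrightarrow> m = n"
  unfolding is_max_def by (meson le_antisym subsetD)

lemma bottom_elem_is_min: "is_min A (carrier A) m \<Longrightarrow> is_min A (carrier A) (bottom_elem A)"
  unfolding bottom_elem_def by (rule theI) (auto intro: is_min_unique)

end

text \<open>The gluing is verified through its order: bounds enter as equivalences, and the lattice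
  identities follow since an element is determined by what lies below it, or above it. This spares
  checking associativity of meet and join region by region.\<close>

lemma integral_residuated_latticeI:
  fixes A :: "'a reslat"
  assumes "monoid A"
    and meet: "\<And>x y. \<lbrakk>x \<in> carrier A; y \<in> carrier A\<rbrakk> \<Longrightarrow> rl_meet A x y \<in> carrier A"
    and join: "\<And>x y. \<lbrakk>x \<in> carrier A; y \<in> carrier A\<rbrakk> \<Longrightarrow> rl_join A x y \<in> carrier A"
    and div: "\<And>x y. \<lbrakk>x \<in> carrier A; y \<in> carrier A\<rbrakk> \<Longrightarrow> ldiv A x y \<in> carrier A"
      "\<And>x y. \<lbrakk>x \<in> carrier A; y \<in> carrier A\<rbrakk> \<Longrightarrow> rdiv A x y \<in> carrier A"
    and refl: "\<And>x. x \<in> carrier A \<Longrightarrow> rl_le A x x"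
    and antisym: "\<And>x y. \<lbrakk>rl_le A x y; rl_le A y x; x \<in> carrier A; y \<in> carrier A\<rbrakk> \<Longrightarrow> x = y"
    and trans: "\<And>x y z. \<lbrakk>rl_le A x y; rl_le A y z;
        x \<in> carrier A; y \<in> carrier A; z \<in> carrier A\<rbrakk> \<Longrightarrow> rl_le A x z"
    and glb: "\<And>x y z. \<lbrakk>x \<in> carrier A; y \<in> carrier A; z \<in> carrier A\<rbrakk>
      \<Longrightarrow> rl_le A z (rl_meet A x y) \<longleftrightarrow> rl_le A z x \<and> rl_le A z y"
    and lub: "\<And>x y z. \<lbrakk>x \<in> carrier A; y \<in> carrier A; z \<in> carrier A\<rbrakk>
      \<Longrightarrow> rl_le A (rl_join A x y) z \<longleftrightarrow> rl_le A x z \<and> rl_le A y z"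
    and res: "\<And>x y z. \<lbrakk>x \<in> carrier A; y \<in> carrier A; z \<in> carrier A\<rbrakk>
      \<Longrightarrow> rl_le A (x \<otimes>\<^bsub>A\<^esub> y) z \<longleftrightarrow> rl_le A y (ldiv A x z)"
      "\<And>x y z. \<lbrakk>x \<in> carrier A; y \<in> carrier A; z \<in> carrier A\<rbrakk>
      \<Longrightarrow> rl_le A (x \<otimes>\<^bsub>A\<^esub> y) z \<longleftrightarrow> rl_le A x (rdiv A z y)"
    and top: "\<And>x. x \<in> carrier A \<Longrightarrow> rl_le A x \<one>\<^bsub>A\<^esub>"
  shows "integral_residuated_lattice A"
proof -
  interpret monoid A by fact
  have meet_eqI: "m = n"
    if "m \<in> carrier A" "n \<in> carrier A" "\<And>z. z \<in> carrier A \<Longrightarrow> rl_le A z m \<longleftrightarrow> rl_le A z n" for m n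
    using that refl antisym by blast
  have join_eqI: "m = n"
    if "m \<in> carrier A" "n \<in> carrier A" "\<And>z. z \<in> carrier A \<Longrightarrow> rl_le A m z \<longleftrightarrow> rl_le A n z" for m n
    using that refl antisym by blast
  show ?thesis
  proof
    fix x y assume xy: "x \<in> carrier A" "y \<in> carrier A"
    have "rl_le A x (rl_join A x y)" "rl_le A (rl_meet A x y) x"
      using xy glb[of x y "rl_meet A x y"] lub[of x y "rl_join A x y"] meet join refl by blast+
    then show "rl_meet A x (rl_join A x y) = x"
      by (simp add: rl_le_def)
    show "rl_join A x (rl_meet A x y) = x"
    proof (rule antisym)
      show "rl_le A (rl_join A x (rl_meet A x y)) x"
        using xy \<open>rl_le A (rl_meet A x y) x\<close> lub meet refl by simp
      show "rl_le A x (rl_join A x (rl_meet A x y))"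
        using xy lub[of x "rl_meet A x y" "rl_join A x (rl_meet A x y)"] meet join refl by simp
    qed (use xy meet join in auto)
    show "rl_meet A x y = rl_meet A y x"
      by (rule meet_eqI) (use xy meet glb in auto)
    show "rl_join A x y = rl_join A y x"
      by (rule join_eqI) (use xy join lub in auto)
    fix z assume z: "z \<in> carrier A"
    show "rl_meet A (rl_meet A x y) z = rl_meet A x (rl_meet A y z)"
      by (rule meet_eqI) (use xy z meet glb in auto)
    show "rl_join A (rl_join A x y) z = rl_join A x (rl_join A y z)"
      by (rule join_eqI) (use xy z join lub in auto)
  qed (simp_all add: meet join div top flip: res)
qed

text \<open>The meet fixes the order; the order and the product fix each division as the largest
  solution of an inequality, and the order fixes the join as least upper bound. Uniqueness of the
  gluing thus comes down to meets and products.\<close>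

lemma agree_on_if_meet_mult_agree:
  assumes "integral_residuated_lattice A" "integral_residuated_lattice A'"
    and car: "carrier A = S" "carrier A' = S"
    and one: "\<one>\<^bsub>A\<^esub> = \<one>\<^bsub>A'\<^esub>"
    and mult: "\<And>x y. \<lbrakk>x \<in> S; y \<in> S\<rbrakk> \<Longrightarrow> x \<otimes>\<^bsub>A\<^esub> y = x \<otimes>\<^bsub>A'\<^esub> y"
    and meet: "\<And>x y. \<lbrakk>x \<in> S; y \<in> S\<rbrakk> \<Longrightarrow> rl_meet A x y = rl_meet A' x y"
  shows "agree_on S A A'"
proof -
  interpret A: integral_residuated_lattice A by fact
  interpret A': integral_residuated_lattice A' by fact
  have le: "rl_le A x y \<longleftrightarrow> rl_le A' x y" if "x \<in> S" "y \<in> S" for x y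
    using that meet by (simp add: rl_le_def)
  \<comment> \<open>The two orders coincide on \<open>S\<close>; taking z = m and z = n gives both
    inequalities.\<close>
  have below_eqI: "m = n"
    if "m \<in> S" "n \<in> S" "\<And>z. z \<in> S \<Longrightarrow> rl_le A z m \<longleftrightarrow> rl_le A' z n" for m n
  proof -
    have "rl_le A' m n" "rl_le A n m"
      using that A.le_refl[of m] A'.le_refl[of n] car by auto
    then show ?thesis
      using that A.le_antisym le car by simp
  qed
  have "ldiv A x y = ldiv A' x y" if xy: "x \<in> S" "y \<in> S" for x y
  proof (rule below_eqI)
    fix z assume z: "z \<in> S"
    have "rl_le A z (ldiv A x y) \<longleftrightarrow> rl_le A (x \<otimes>\<^bsub>A\<^esub> z) y"
      using xy z car A.residuation_left by simp
    also have "\<dots> \<longleftrightarrow> rl_le A' (x \<otimes>\<^bsub>A'\<^esub> z) y"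
      using xy z car A'.m_closed mult le by simp
    also have "\<dots> \<longleftrightarrow> rl_le A' z (ldiv A' x y)"
      using xy z car A'.residuation_left by simp
    finally show "rl_le A z (ldiv A x y) \<longleftrightarrow> rl_le A' z (ldiv A' x y)" .
  qed (use xy car A.ldiv_closed A'.ldiv_closed in auto)
  moreover have "rdiv A x y = rdiv A' x y" if xy: "x \<in> S" "y \<in> S" for x y
  proof (rule below_eqI)
    fix z assume z: "z \<in> S"
    have "rl_le A z (rdiv A x y) \<longleftrightarrow> rl_le A (z \<otimes>\<^bsub>A\<^esub> y) x"
      using xy z car A.residuation_right by simp
    also have "\<dots> \<longleftrightarrow> rl_le A' (z \<otimes>\<^bsub>A'\<^esub> y) x"
      using xy z car A'.m_closed mult le by simp
    also have "\<dots> \<longleftrightarrow> rl_le A' z (rdiv A' x y)"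
      using xy z car A'.residuation_right by simp
    finally show "rl_le A z (rdiv A x y) \<longleftrightarrow> rl_le A' z (rdiv A' x y)" .
  qed (use xy car A.rdiv_closed A'.rdiv_closed in auto)
  moreover have "rl_join A x y = rl_join A' x y" if "x \<in> S" "y \<in> S" for x y
  proof -
    have cl: "rl_join A x y \<in> S" "rl_join A' x y \<in> S"
      using that car A.join_closed A'.join_closed by auto
    have "rl_le A (rl_join A x y) (rl_join A' x y)"
      by (rule A.join_least) (use that cl car le A'.join_ge1 A'.join_ge2 in auto)
    moreover have "rl_le A' (rl_join A' x y) (rl_join A x y)"
      by (rule A'.join_least) (use that cl car le[symmetric] A.join_ge1 A.join_ge2 in auto)
    ultimately show ?thesis
      using cl car le A.le_antisym by blast
  qed
  ultimately show ?thesis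
    using one mult meet by (simp add: agree_on_def agree_except_join_on_def agree_join_on_def)
qed

section \<open>Congruence filters above all other elements\<close>

text \<open>This captures what \<open>B\<close> and \<open>C\<close> share: for \<open>B\<close> the
  condition \<open>above\<close> is a clause of \<open>compatible\<close>, for \<open>C\<close> it
  is a hypothesis of its own. The calculus with F is developed once for both.\<close>

locale congruence_filter_on_top = integral_residuated_lattice A for A :: "'a reslat" (structure) +
  fixes F :: "'a set"
  assumes filter: "congruence_filter A F"
    and above: "\<lbrakk>f \<in> F; x \<in> carrier A; x \<notin> F\<rbrakk> \<Longrightarrow> rl_less A x f"
begin

lemma filter_carrier: "f \<in> F \<Longrightarrow> f \<in> carrier A"
  using filter by (auto simp: congruence_filter_def)

lemma filter_upward: "\<lbrakk>rl_le A f x; f \<in> F; x \<in> carrier A\<rbrakk> \<Longrightarrow> x \<in> F"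
  using filter by (auto simp: congruence_filter_def)

lemma filter_mult: "\<lbrakk>f \<in> F; g \<in> F\<rbrakk> \<Longrightarrow> f \<otimes> g \<in> F"
  using filter by (auto simp: congruence_filter_def)

lemma filter_conj_right: "\<lbrakk>f \<in> F; x \<in> carrier A\<rbrakk> \<Longrightarrow> rdiv A (x \<otimes> f) x \<in> F"
  using filter by (auto simp: congruence_filter_def)

lemma filter_conj_left: "\<lbrakk>f \<in> F; x \<in> carrier A\<rbrakk> \<Longrightarrow> ldiv A x (f \<otimes> x) \<in> F"
  using filter by (auto simp: congruence_filter_def)

lemma one_filter: "\<one> \<in> F"
  using filter filter_upward one_top by (auto simp: congruence_filter_def)

lemma nonfilter_le_filter: "\<lbrakk>f \<in> F; x \<in> carrier A; x \<notin> F\<rbrakk> \<Longrightarrow> rl_le A x f"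
  using above by (simp add: rl_less_def)

lemma filter_not_le: "\<lbrakk>f \<in> F; x \<in> carrier A; x \<notin> F\<rbrakk> \<Longrightarrow> \<not> rl_le A f x"
  using filter_upward by blast

lemma mult_nonfilter:
  "\<lbrakk>x \<in> carrier A; y \<in> carrier A; x \<notin> F \<or> y \<notin> F\<rbrakk> \<Longrightarrow> x \<otimes> y \<notin> F"
  using filter_upward mult_le1 mult_le2 by blast

lemma meet_nonfilter:
  "\<lbrakk>x \<in> carrier A; y \<in> carrier A; x \<notin> F \<or> y \<notin> F\<rbrakk> \<Longrightarrow> rl_meet A x y \<notin> F"
  using filter_upward meet_le1 meet_le2 by blast

text \<open>By integrality xy lies below both factors, hence below their meet, so closure under
  products suffices.\<close>

lemma meet_filter: "\<lbrakk>x \<in> F; y \<in> F\<rbrakk> \<Longrightarrow> rl_meet A x y \<in> F"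
  by (meson filter_carrier filter_mult filter_upward m_closed meet_closed meet_greatest
      mult_le1 mult_le2)

section \<open>The preorder given by \<open>ldiv A x y\<close> in F\<close>

lemma ldiv_filter_D: "\<lbrakk>x \<in> F; y \<in> carrier A; ldiv A x y \<in> F\<rbrakk> \<Longrightarrow> y \<in> F"
  by (meson filter_carrier filter_mult filter_upward mult_ldiv_le)

lemma rdiv_filter_D: "\<lbrakk>x \<in> F; y \<in> carrier A; rdiv A y x \<in> F\<rbrakk> \<Longrightarrow> y \<in> F"
  by (meson filter_carrier filter_mult filter_upward rdiv_mult_le)

text \<open>The quotient itself is the largest candidate for f. Trading membership of a quotient for
  a product inequality lets the later arguments compute with factors from F.\<close>

lemma ldiv_filter_iff:
  "\<lbrakk>x \<in> carrier A; y \<in> carrier A\<rbrakk> \<Longrightarrow> ldiv A x y \<in> F \<longleftrightarrow> (\<exists>f\<in>F. rl_le A (x \<otimes> f) y)"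
  by (meson filter_carrier filter_upward ldiv_closed mult_ldiv_le residuation_left)

lemma rdiv_filter_iff:
  "\<lbrakk>x \<in> carrier A; y \<in> carrier A\<rbrakk> \<Longrightarrow> rdiv A y x \<in> F \<longleftrightarrow> (\<exists>f\<in>F. rl_le A (f \<otimes> x) y)"
  by (meson filter_carrier filter_upward rdiv_closed rdiv_mult_le residuation_right)

text \<open>Closure under conjugates moves a factor from F across x: g = (xf)/x lies in F and gx
  \<le> xf, and symmetrically in the other direction.\<close>

lemma ldiv_filter_iff_rdiv_filter:
  assumes xy: "x \<in> carrier A" "y \<in> carrier A"
  shows "ldiv A x y \<in> F \<longleftrightarrow> rdiv A y x \<in> F"
proof
  assume "ldiv A x y \<in> F"
  then obtain f where f: "f \<in> F" "rl_le A (x \<otimes> f) y"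
    using xy ldiv_filter_iff by blast
  let ?g = "rdiv A (x \<otimes> f) x"
  have "?g \<in> F" using f xy filter_conj_right by blast
  moreover have "rl_le A (?g \<otimes> x) y"
    using f xy rdiv_mult_le[of x "x \<otimes> f"] le_trans filter_carrier m_closed rdiv_closed by meson
  ultimately show "rdiv A y x \<in> F"
    using xy rdiv_filter_iff by blast
next
  assume "rdiv A y x \<in> F"
  then obtain f where f: "f \<in> F" "rl_le A (f \<otimes> x) y"
    using xy rdiv_filter_iff by blast
  let ?g = "ldiv A x (f \<otimes> x)"
  have "?g \<in> F" using f xy filter_conj_left by blast
  moreover have "rl_le A (x \<otimes> ?g) y"
    using f xy mult_ldiv_le[of x "f \<otimes> x"] le_trans filter_carrier m_closed ldiv_closed by meson
  ultimately show "ldiv A x y \<in> F"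
    using xy ldiv_filter_iff by blast
qed

lemma ldiv_filter_if_le: "\<lbrakk>rl_le A x y; x \<in> carrier A; y \<in> carrier A\<rbrakk> \<Longrightarrow> ldiv A x y \<in> F"
  by (metis ldiv_filter_iff one_filter r_one)

text \<open>Witnesses multiply: xf \<le> y and yg \<le> z give x(fg) \<le> z.\<close>

lemma ldiv_filter_trans:
  assumes "ldiv A x y \<in> F" "ldiv A y z \<in> F" and car: "x \<in> carrier A" "y \<in> carrier A" "z \<in> carrier A"
  shows "ldiv A x z \<in> F"
proof -
  obtain f g where fg: "f \<in> F" "rl_le A (x \<otimes> f) y" "g \<in> F" "rl_le A (y \<otimes> g) z"
    using assms ldiv_filter_iff[of x y] ldiv_filter_iff[of y z] by auto
  have "rl_le A (x \<otimes> (f \<otimes> g)) (y \<otimes> g)"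
    using fg car filter_carrier mult_mono_left[of "x \<otimes> f" y g] by (simp add: m_assoc)
  then have "rl_le A (x \<otimes> (f \<otimes> g)) z"
    using fg car filter_carrier le_trans[of _ "y \<otimes> g" z] by simp
  then show ?thesis
    using fg car filter_mult ldiv_filter_iff[of x z] by auto
qed

lemma ldiv_filter_mult_left:
  assumes "ldiv A x y \<in> F" and car: "x \<in> carrier A" "y \<in> carrier A" "z \<in> carrier A"
  shows "ldiv A (z \<otimes> x) (z \<otimes> y) \<in> F"
proof -
  obtain f where f: "f \<in> F" "rl_le A (x \<otimes> f) y"
    using assms ldiv_filter_iff[of x y] by auto
  then have "rl_le A (z \<otimes> x \<otimes> f) (z \<otimes> y)"
    using car filter_carrier mult_mono_right[of "x \<otimes> f" y z] by (simp add: m_assoc)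
  then show ?thesis
    using f car ldiv_filter_iff[of "z \<otimes> x"] by auto
qed

text \<open>Multiplying by z on the right calls for a witness on the left of x, so both ends of the
  argument switch to the other division.\<close>

lemma ldiv_filter_mult_right:
  assumes "ldiv A x y \<in> F" and car: "x \<in> carrier A" "y \<in> carrier A" "z \<in> carrier A"
  shows "ldiv A (x \<otimes> z) (y \<otimes> z) \<in> F"
proof -
  obtain f where f: "f \<in> F" "rl_le A (f \<otimes> x) y"
    using assms ldiv_filter_iff_rdiv_filter[of x y] rdiv_filter_iff[of x y] by auto
  then have "rl_le A (f \<otimes> (x \<otimes> z)) (y \<otimes> z)"
    using car filter_carrier mult_mono_left[of "f \<otimes> x" y z] by (simp add: m_assoc)
  then show ?thesis
    using f car ldiv_filter_iff_rdiv_filter[of "x \<otimes> z"] rdiv_filter_iff[of "x \<otimes> z"] by auto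
qed

text \<open>Integrality gives xf, fx \<le> x. In the other direction f itself is a witness for xf,
  and closure under conjugates settles fx. Hence both products stay in the class of x.\<close>

lemma mult_filter_cong:
  assumes "x \<in> carrier A" "f \<in> F"
  shows "ldiv A x (x \<otimes> f) \<in> F" "ldiv A (x \<otimes> f) x \<in> F"
    "ldiv A x (f \<otimes> x) \<in> F" "ldiv A (f \<otimes> x) x \<in> F"
proof -
  have f: "f \<in> carrier A" using assms filter_carrier by blast
  show "ldiv A x (x \<otimes> f) \<in> F"
    using assms f ldiv_filter_iff[of x "x \<otimes> f"] le_refl by blast
  show "ldiv A (x \<otimes> f) x \<in> F" "ldiv A (f \<otimes> x) x \<in> F"
    using assms f by (auto intro: ldiv_filter_if_le mult_le1 mult_le2)
  show "ldiv A x (f \<otimes> x) \<in> F"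
    using assms filter_conj_left by blast
qed

lemma mem_filter_class_iff:
  "x \<in> carrier A \<Longrightarrow> y \<in> filter_class A F x \<longleftrightarrow> y \<in> carrier A \<and> ldiv A x y \<in> F \<and> ldiv A y x \<in> F"
  by (auto simp: filter_class_def filter_cong_def)

end

section \<open>Extremal elements of the congruence classes\<close>

locale compatible_filter = integral_residuated_lattice A for A :: "'a reslat" (structure) +
  fixes F :: "'a set"
  assumes congruence_filter: "congruence_filter A F"
    and compatible: "compatible A F"

sublocale compatible_filter \<subseteq> congruence_filter_on_top
  using congruence_filter compatible by unfold_locales (auto simp: compatible_def)

context compatible_filter
begin

text \<open>This justifies the definite description: existence is a clause of compatibility,
  uniqueness is antisymmetry.\<close>

lemma sigma_is_min:
  assumes "x \<in> carrier A" "x \<notin> F"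
  shows "is_min A (filter_class A F x) (sigma A F x)"
proof -
  have "\<exists>m. is_min A (filter_class A F x) m"
    using compatible assms by (auto simp: compatible_def)
  moreover have "filter_class A F x \<subseteq> carrier A"
    using assms mem_filter_class_iff by auto
  ultimately show ?thesis
    unfolding sigma_def using is_min_unique by (metis theI)
qed

lemma gamma_is_max:
  assumes "x \<in> carrier A" "x \<notin> F"
  shows "is_max A (filter_class A F x) (gamma A F x)"
proof -
  have "\<exists>m. is_max A (filter_class A F x) m"
    using compatible assms by (auto simp: compatible_def)
  moreover have "filter_class A F x \<subseteq> carrier A"
    using assms mem_filter_class_iff by auto
  ultimately show ?thesis
    unfolding gamma_def using is_max_unique by (metis theI)
qed

lemma sigma_closed: "\<lbrakk>x \<in> carrier A; x \<notin> F\<rbrakk> \<Longrightarrow> sigma A F x \<in> carrier A"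
  using sigma_is_min by (auto simp: is_min_def mem_filter_class_iff)

lemma gamma_closed: "\<lbrakk>x \<in> carrier A; x \<notin> F\<rbrakk> \<Longrightarrow> gamma A F x \<in> carrier A"
  using gamma_is_max by (auto simp: is_max_def mem_filter_class_iff)

lemma ldiv_sigma: "\<lbrakk>x \<in> carrier A; x \<notin> F\<rbrakk> \<Longrightarrow> ldiv A x (sigma A F x) \<in> F"
  using sigma_is_min by (auto simp: is_min_def mem_filter_class_iff)

lemma ldiv_gamma: "\<lbrakk>x \<in> carrier A; x \<notin> F\<rbrakk> \<Longrightarrow> ldiv A (gamma A F x) x \<in> F"
  using gamma_is_max by (auto simp: is_max_def mem_filter_class_iff)

lemma self_in_class: "x \<in> carrier A \<Longrightarrow> x \<in> filter_class A F x"
  by (simp add: mem_filter_class_iff ldiv_filter_if_le le_refl)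

lemma sigma_le: "\<lbrakk>x \<in> carrier A; x \<notin> F\<rbrakk> \<Longrightarrow> rl_le A (sigma A F x) x"
  using sigma_is_min self_in_class by (auto simp: is_min_def)

lemma sigma_nonfilter: "\<lbrakk>x \<in> carrier A; x \<notin> F\<rbrakk> \<Longrightarrow> sigma A F x \<notin> F"
  using filter_upward sigma_le by blast

text \<open>Were \<gamma>(x) in F, detachment along \<open>ldiv A (gamma A F x) x\<close> in F would
  put x into F.\<close>

lemma gamma_nonfilter: "\<lbrakk>x \<in> carrier A; x \<notin> F\<rbrakk> \<Longrightarrow> gamma A F x \<notin> F"
  using ldiv_filter_D ldiv_gamma by blast

text \<open>A witness f with xf \<le> y puts xf into the class of x, hence \<sigma>(x) \<le> xf
  \<le> y. Here y may also lie in F, as happens in the mixed residuation cases.\<close>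

lemma sigma_le_iff:
  assumes x: "x \<in> carrier A" "x \<notin> F" and y: "y \<in> carrier A"
  shows "rl_le A (sigma A F x) y \<longleftrightarrow> ldiv A x y \<in> F"
proof
  assume "rl_le A (sigma A F x) y"
  then show "ldiv A x y \<in> F"
    using x y ldiv_filter_trans[of x "sigma A F x" y]
    by (simp add: ldiv_sigma ldiv_filter_if_le sigma_closed)
next
  assume "ldiv A x y \<in> F"
  then obtain f where f: "f \<in> F" "rl_le A (x \<otimes> f) y"
    using x y ldiv_filter_iff by blast
  have "ldiv A x (x \<otimes> f) \<in> F" "ldiv A (x \<otimes> f) x \<in> F"
    using f x mult_filter_cong by blast+
  then have "rl_le A (sigma A F x) (x \<otimes> f)"
    using sigma_is_min[OF x] x f filter_carrier by (auto simp: is_min_def mem_filter_class_iff)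
  then show "rl_le A (sigma A F x) y"
    using f x y filter_carrier le_trans[of _ "x \<otimes> f" y] sigma_closed by simp
qed

lemma le_gamma_iff:
  assumes x: "x \<in> carrier A" and y: "y \<in> carrier A" "y \<notin> F"
  shows "rl_le A x (gamma A F y) \<longleftrightarrow> ldiv A x y \<in> F"
proof
  assume "rl_le A x (gamma A F y)"
  then show "ldiv A x y \<in> F"
    using x y ldiv_filter_trans[of x "gamma A F y" y]
    by (simp add: ldiv_gamma ldiv_filter_if_le gamma_closed)
next
  assume "ldiv A x y \<in> F"
  then obtain f where f: "f \<in> F" "rl_le A (x \<otimes> f) y"
    using x y ldiv_filter_iff by blast
  \<comment> \<open>The element x need not be congruent to y, but its join with y is: x and y both
    lie below y/f, hence so does the join j, and jf \<le> y.\<close>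
  let ?j = "rl_join A x y"
  have j: "?j \<in> carrier A" using x y join_closed by blast
  have "rl_le A ?j (rdiv A y f)"
    by (rule join_least)
      (use f x y filter_carrier rdiv_closed le_rdiv in \<open>auto simp flip: residuation_right\<close>)
  then have "ldiv A ?j y \<in> F"
    using f j y filter_carrier residuation_right ldiv_filter_iff by blast
  moreover have "ldiv A y ?j \<in> F"
    using x y j join_ge2 ldiv_filter_if_le by blast
  ultimately have "rl_le A ?j (gamma A F y)"
    using gamma_is_max[OF y] y j by (auto simp: is_max_def mem_filter_class_iff)
  then show "rl_le A x (gamma A F y)"
    using x y j join_ge1 le_trans[of x ?j] gamma_closed by simp
qed

section \<open>Interaction of \<sigma> with the product\<close>

lemma sigma_cong:
  assumes "ldiv A x y \<in> F" "ldiv A y x \<in> F"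
    and "x \<in> carrier A" "x \<notin> F" "y \<in> carrier A" "y \<notin> F"
  shows "sigma A F x = sigma A F y"
proof (rule le_antisym)
  show "rl_le A (sigma A F x) (sigma A F y)"
    using assms ldiv_filter_trans[of x y "sigma A F y"]
    by (simp add: sigma_le_iff sigma_closed ldiv_sigma)
  show "rl_le A (sigma A F y) (sigma A F x)"
    using assms ldiv_filter_trans[of y x "sigma A F x"]
    by (simp add: sigma_le_iff sigma_closed ldiv_sigma)
qed (use assms sigma_closed in auto)

lemma sigma_sigma: "\<lbrakk>x \<in> carrier A; x \<notin> F\<rbrakk> \<Longrightarrow> sigma A F (sigma A F x) = sigma A F x"
  by (rule sigma_cong)
    (auto simp: ldiv_sigma sigma_closed sigma_nonfilter sigma_le ldiv_filter_if_le)

lemma sigma_mult_filter: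
  assumes "x \<in> carrier A" "x \<notin> F" "f \<in> F"
  shows "sigma A F (x \<otimes> f) = sigma A F x" "sigma A F (f \<otimes> x) = sigma A F x"
  using assms filter_carrier mult_nonfilter mult_filter_cong by (auto intro!: sigma_cong)

text \<open>The product stays in the class and, by integrality, lies below \<sigma>(x); the minimum
  admits nothing smaller.\<close>

lemma mult_filter_sigma:
  assumes "x \<in> carrier A" "x \<notin> F" "f \<in> F"
  shows "sigma A F x \<otimes> f = sigma A F x" "f \<otimes> sigma A F x = sigma A F x"
proof -
  let ?s = "sigma A F x"
  have s: "?s \<in> carrier A" "?s \<notin> F" and f: "f \<in> carrier A"
    using assms sigma_closed sigma_nonfilter filter_carrier by auto
  have "rl_le A ?s (?s \<otimes> f)" "rl_le A ?s (f \<otimes> ?s)"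
    using assms s f mult_filter_cong[of ?s f] ldiv_filter_trans[of x ?s]
    by (simp_all add: sigma_le_iff ldiv_sigma)
  then show "?s \<otimes> f = ?s" "f \<otimes> ?s = ?s"
    using s f by (auto intro!: le_antisym simp: mult_le1 mult_le2)
qed

text \<open>Compatibility says that x \<sigma>(y) is the minimum of some class. It is congruent to
  xy, so the class is that of xy. The other side is symmetric.\<close>

lemma mult_sigma:
  assumes x: "x \<in> carrier A" "x \<notin> F" and y: "y \<in> carrier A" "y \<notin> F"
  shows "x \<otimes> sigma A F y = sigma A F (x \<otimes> y)" "sigma A F x \<otimes> y = sigma A F (x \<otimes> y)"
proof -
  \<comment> \<open>By idempotence, lying in the image of \<sigma> means being the minimum of one's
    own class.\<close>
  have fixed: "sigma A F s = s" if "s \<in> sigma A F ` (carrier A - F)" for s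
    using that sigma_sigma by auto
  have "x \<otimes> sigma A F y \<in> sigma A F ` (carrier A - F)"
    using compatible x y by (force simp: compatible_def)
  then have "x \<otimes> sigma A F y = sigma A F (x \<otimes> sigma A F y)"
    by (rule fixed[symmetric])
  also have "\<dots> = sigma A F (x \<otimes> y)"
    by (rule sigma_cong)
      (use x y in \<open>auto intro!: ldiv_filter_mult_left
        simp: ldiv_sigma sigma_closed sigma_le ldiv_filter_if_le mult_nonfilter\<close>)
  finally show "x \<otimes> sigma A F y = sigma A F (x \<otimes> y)" .
  have "sigma A F x \<otimes> y \<in> sigma A F ` (carrier A - F)"
    using compatible x y by (force simp: compatible_def)
  then have "sigma A F x \<otimes> y = sigma A F (sigma A F x \<otimes> y)"
    by (rule fixed[symmetric])
  also have "\<dots> = sigma A F (x \<otimes> y)"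
    by (rule sigma_cong)
      (use x y in \<open>auto intro!: ldiv_filter_mult_right
        simp: ldiv_sigma sigma_closed sigma_le ldiv_filter_if_le mult_nonfilter\<close>)
  finally show "sigma A F x \<otimes> y = sigma A F (x \<otimes> y)" .
qed

end

section \<open>The gluing\<close>

text \<open>\<open>agree\<close> makes explicit what an intersection of two algebras presupposes: on
  F they have the same operations, and the units coincide. \<open>bottom\<close> supplies 0_C
  exactly where the modified join refers to it.\<close>

locale gluing_pair = B: compatible_filter B F + C: congruence_filter_on_top C F
  for B C :: "'a reslat" and F :: "'a set" +
  assumes inter: "carrier B \<inter> carrier C = F"
    and agree: "agree_on F B C"
    and bottom: "\<lbrakk>x \<in> carrier B; x \<notin> F; y \<in> carrier B; y \<notin> F; rl_join B x y \<in> F\<rbrakk>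
      \<Longrightarrow> \<exists>m. is_min C (carrier C) m"
begin

abbreviation "D \<equiv> gluing_sum B F C"
abbreviation "P \<equiv> carrier B - F"
abbreviation "Q \<equiv> carrier C - F"

section \<open>Operations of the sum, region by region\<close>

lemma filter_sub: "x \<in> F \<Longrightarrow> x \<in> carrier B" "x \<in> F \<Longrightarrow> x \<in> carrier C"
  using inter by auto

lemma one_eq: "\<one>\<^bsub>C\<^esub> = \<one>\<^bsub>B\<^esub>"
  using agree by (simp add: agree_on_def agree_except_join_on_def)

lemma carrier_cases:
  assumes "x \<in> carrier B \<union> carrier C"
  obtains (P) "x \<in> P" | (Q) "x \<in> Q" | (F) "x \<in> F"
  using assms by blast

lemma agree_filter:
  assumes "x \<in> F" "y \<in> F"
  shows "x \<otimes>\<^bsub>C\<^esub> y = x \<otimes>\<^bsub>B\<^esub> y" "rl_meet C x y = rl_meet B x y" "rl_join C x y = rl_join B x y"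
    "ldiv C x y = ldiv B x y" "rdiv C x y = rdiv B x y"
  using agree assms
  by (auto simp: agree_on_def agree_except_join_on_def agree_join_on_def)

lemma both_carriers: "\<lbrakk>x \<in> carrier B; x \<in> carrier C\<rbrakk> \<Longrightarrow> x \<in> F"
  using inter by blast

lemma carrier_sum: "carrier D = carrier B \<union> carrier C"
  by (simp add: gluing_sum_def)

lemma one_sum: "\<one>\<^bsub>D\<^esub> = \<one>\<^bsub>B\<^esub>"
  by (simp add: gluing_sum_def)

lemma sum_B:
  assumes "x \<in> carrier B" "y \<in> carrier B"
  shows "x \<otimes>\<^bsub>D\<^esub> y = x \<otimes>\<^bsub>B\<^esub> y" "rl_meet D x y = rl_meet B x y"
    "ldiv D x y = ldiv B x y" "rdiv D x y = rdiv B x y"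
    "rl_le D x y \<longleftrightarrow> rl_le B x y"
    "rl_join D x y =
      (if x \<notin> F \<and> y \<notin> F \<and> rl_join B x y \<in> F then bottom_elem C else rl_join B x y)"
  using assms by (simp_all add: gluing_sum_def rl_le_def)

text \<open>The definitions test membership in \<open>B\<close> first, so for two elements of F they
  return the operation of \<open>B\<close>; \<open>agree_filter\<close> turns it into that of
  \<open>C\<close>. The exceptional join clause cannot apply, as elements of P are not in
  \<open>C\<close>.\<close>

lemma sum_C:
  assumes "x \<in> carrier C" "y \<in> carrier C"
  shows "x \<otimes>\<^bsub>D\<^esub> y = x \<otimes>\<^bsub>C\<^esub> y" "rl_meet D x y = rl_meet C x y"
    "ldiv D x y = ldiv C x y" "rdiv D x y = rdiv C x y"
    "rl_le D x y \<longleftrightarrow> rl_le C x y" "rl_join D x y = rl_join C x y"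
  using assms both_carriers[of x] both_carriers[of y] agree_filter[of x y]
  by (auto simp: gluing_sum_def rl_le_def)

lemma sum_PQ:
  assumes "x \<in> P" "y \<in> Q"
  shows "x \<otimes>\<^bsub>D\<^esub> y = sigma B F x" "rl_meet D x y = x" "rl_join D x y = y"
    "ldiv D x y = \<one>\<^bsub>B\<^esub>" "rdiv D x y = gamma B F x" "rl_le D x y"
  using assms inter by (auto simp: gluing_sum_def rl_le_def)

lemma sum_QP:
  assumes "x \<in> Q" "y \<in> P"
  shows "x \<otimes>\<^bsub>D\<^esub> y = sigma B F y" "rl_meet D x y = y" "rl_join D x y = x"
    "ldiv D x y = gamma B F y" "rdiv D x y = \<one>\<^bsub>B\<^esub>" "\<not> rl_le D x y"
  using assms inter by (auto simp: gluing_sum_def rl_le_def)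

lemma bottom_elem_min:
  assumes "x \<in> P" "y \<in> P" "rl_join B x y \<in> F"
  shows "bottom_elem C \<in> carrier C" "\<And>c. c \<in> carrier C \<Longrightarrow> rl_le C (bottom_elem C) c"
  using assms bottom C.bottom_elem_is_min by (auto simp: is_min_def) blast+

section \<open>Order and product between P, Q and F\<close>

lemma le_P_iff: "\<lbrakk>x \<in> carrier D; y \<in> P\<rbrakk> \<Longrightarrow> rl_le D x y \<longleftrightarrow> x \<in> P \<and> rl_le B x y"
  unfolding carrier_sum
  by (elim carrier_cases; use sum_QP(6)[of x y] in \<open>auto simp: sum_B B.filter_not_le filter_sub\<close>)

lemma P_le_C: "\<lbrakk>x \<in> P; y \<in> carrier C\<rbrakk> \<Longrightarrow> rl_le D x y"
  by (cases "y \<in> F") (auto simp: sum_B sum_PQ filter_sub B.nonfilter_le_filter)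

lemma Q_le_iff: "\<lbrakk>x \<in> Q; y \<in> carrier B\<rbrakk> \<Longrightarrow> rl_le D x y \<longleftrightarrow> y \<in> F"
  by (cases "y \<in> F") (auto simp: sum_C sum_QP filter_sub C.nonfilter_le_filter)

lemma P_mult:
  "\<lbrakk>x \<in> P; y \<in> carrier B\<rbrakk> \<Longrightarrow> x \<otimes>\<^bsub>B\<^esub> y \<in> P" "\<lbrakk>x \<in> carrier B; y \<in> P\<rbrakk> \<Longrightarrow> x \<otimes>\<^bsub>B\<^esub> y \<in> P"
  using B.mult_nonfilter by auto

lemma Q_mult:
  "\<lbrakk>x \<in> Q; y \<in> carrier C\<rbrakk> \<Longrightarrow> x \<otimes>\<^bsub>C\<^esub> y \<in> Q" "\<lbrakk>x \<in> carrier C; y \<in> Q\<rbrakk> \<Longrightarrow> x \<otimes>\<^bsub>C\<^esub> y \<in> Q"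
  using C.mult_nonfilter by auto

lemma P_sigma: "x \<in> P \<Longrightarrow> sigma B F x \<in> P"
  using B.sigma_closed B.sigma_nonfilter by auto

lemma P_gamma: "x \<in> P \<Longrightarrow> gamma B F x \<in> P"
  using B.gamma_closed B.gamma_nonfilter by auto

text \<open>A factor from Q yields a value of \<sigma>; a factor from \<open>B\<close> is handled by
  integrality and upward closure of F. In residuation, an upper bound from \<open>C\<close> then
  holds automatically.\<close>

lemma P_sum_mult:
  assumes "x \<in> P" "y \<in> carrier D"
  shows "x \<otimes>\<^bsub>D\<^esub> y \<in> P" "y \<otimes>\<^bsub>D\<^esub> x \<in> P"
proof -
  consider "y \<in> carrier B" | "y \<in> Q"
    using assms filter_sub by (auto simp: carrier_sum)
  then have "x \<otimes>\<^bsub>D\<^esub> y \<in> P \<and> y \<otimes>\<^bsub>D\<^esub> x \<in> P"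
  proof cases
    case 1
    then show ?thesis using assms P_mult[of x y] P_mult[of y x] by (simp add: sum_B)
  next
    case 2
    then show ?thesis using assms P_sigma[of x] by (simp add: sum_PQ sum_QP)
  qed
  then show "x \<otimes>\<^bsub>D\<^esub> y \<in> P" "y \<otimes>\<^bsub>D\<^esub> x \<in> P" by auto
qed

section \<open>The monoid of the sum\<close>

lemma mult_closed: "\<lbrakk>x \<in> carrier D; y \<in> carrier D\<rbrakk> \<Longrightarrow> x \<otimes>\<^bsub>D\<^esub> y \<in> carrier D"
  unfolding carrier_sum
  by (elim carrier_cases; use P_sigma in \<open>auto simp: sum_B sum_C sum_PQ sum_QP filter_sub\<close>)

lemma mult_assoc:
  assumes "x \<in> carrier D" "y \<in> carrier D" "z \<in> carrier D"
  shows "x \<otimes>\<^bsub>D\<^esub> y \<otimes>\<^bsub>D\<^esub> z = x \<otimes>\<^bsub>D\<^esub> (y \<otimes>\<^bsub>D\<^esub> z)"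
proof (cases "{x, y, z} \<subseteq> carrier B \<or> {x, y, z} \<subseteq> carrier C")
  case True
  then show ?thesis
    by (auto simp: sum_B sum_C B.m_assoc C.m_assoc)
next
  case False
  \<comment> \<open>Now P and Q both occur among x, y, z. Both bracketings evaluate to \<sigma> of
    the product of the entries from P: an entry from Q only applies \<sigma>, and entries from F are
    absorbed.\<close>
  have sub: "f \<in> carrier B" "f \<in> carrier C" if "f \<in> F" for f
    using that filter_sub by auto
  have B: "b \<in> carrier B" if "b \<in> P" for b using that by simp
  have C: "c \<in> carrier C" if "c \<in> Q" for c using that by simp
  have sig: "sigma B F (sigma B F b) = sigma B F b" if "b \<in> P" for b
    using that B.sigma_sigma by simp
  have sigF: "sigma B F (b \<otimes>\<^bsub>B\<^esub> f) = sigma B F b" "sigma B F (f \<otimes>\<^bsub>B\<^esub> b) = sigma B F b"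
    "sigma B F b \<otimes>\<^bsub>B\<^esub> f = sigma B F b" "f \<otimes>\<^bsub>B\<^esub> sigma B F b = sigma B F b"
    if "b \<in> P" "f \<in> F" for b f
    using that B.sigma_mult_filter B.mult_filter_sigma by auto
  have sigP: "b \<otimes>\<^bsub>B\<^esub> sigma B F b' = sigma B F (b \<otimes>\<^bsub>B\<^esub> b')"
    "sigma B F b \<otimes>\<^bsub>B\<^esub> b' = sigma B F (b \<otimes>\<^bsub>B\<^esub> b')" if "b \<in> P" "b' \<in> P" for b b'
    using that B.mult_sigma by auto
  \<comment> \<open>Membership in P and Q stays folded, so that the conditional rules for the
    regions match the case hypotheses.\<close>
  note [simp del] = Diff_iff
  note rules = sum_PQ sum_QP sum_B(1) sum_C(1) sub B C sig sigF sigP P_mult Q_mult P_sigma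
    B.filter_mult C.filter_mult
  from assms[unfolded carrier_sum] show ?thesis
    by (elim carrier_cases; use False in \<open>simp add: rules\<close>)
qed

lemma sum_monoid: "monoid D"
proof
  fix x assume x: "x \<in> carrier D"
  show "\<one>\<^bsub>D\<^esub> \<otimes>\<^bsub>D\<^esub> x = x" "x \<otimes>\<^bsub>D\<^esub> \<one>\<^bsub>D\<^esub> = x"
    using x B.one_filter filter_sub C.l_one[unfolded one_eq] C.r_one[unfolded one_eq]
    by (auto simp: carrier_sum one_sum sum_B sum_C)
qed (use mult_closed mult_assoc B.one_closed in \<open>auto simp: carrier_sum one_sum\<close>)

section \<open>The lattice order of the sum\<close>

lemma sum_le_one: "x \<in> carrier D \<Longrightarrow> rl_le D x \<one>\<^bsub>B\<^esub>"
  using B.one_filter filter_sub B.one_top C.one_top[unfolded one_eq]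
  by (auto simp: carrier_sum sum_B sum_C)

lemma sum_le_trans:
  assumes "rl_le D x y" "rl_le D y z" "x \<in> carrier D" "y \<in> carrier D" "z \<in> carrier D"
  shows "rl_le D x z"
proof -
  \<comment> \<open>An upper end z in P pulls y and x into P. The last case contradicts x \<le> y,
    since nothing from \<open>C\<close> lies below an element of P.\<close>
  consider "{x, y, z} \<subseteq> carrier B" | "{x, y, z} \<subseteq> carrier C" | "x \<in> P" "z \<in> carrier C"
    | "z \<in> P" | "x \<in> carrier C" "y \<in> P"
    using assms filter_sub by (auto simp: carrier_sum)
  then show ?thesis
  proof cases
    case 1
    then show ?thesis using assms B.le_trans[of x y z] by (simp add: sum_B)
  next
    case 2
    then show ?thesis using assms C.le_trans[of x y z] by (simp add: sum_C)
  next
    case 3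
    then show ?thesis by (rule P_le_C)
  next
    case 4
    then show ?thesis using assms B.le_trans[of x y z] by (auto simp: le_P_iff)
  next
    case 5
    then show ?thesis using assms both_carriers by (auto simp: le_P_iff)
  qed
qed

lemma sum_meet:
  assumes "x \<in> carrier D" "y \<in> carrier D" "z \<in> carrier D"
  shows "rl_le D z (rl_meet D x y) \<longleftrightarrow> rl_le D z x \<and> rl_le D z y"
proof -
  have meet_B: "rl_le B z (rl_meet B x y) \<longleftrightarrow> rl_le B z x \<and> rl_le B z y"
    if "x \<in> carrier B" "y \<in> carrier B" "z \<in> carrier B"
    using that B.meet_greatest[of z x y] B.meet_le1[of x y] B.meet_le2[of x y]
      B.meet_closed[of x y] B.le_trans[of z "rl_meet B x y"] by blast
  have meet_C: "rl_le C z (rl_meet C x y) \<longleftrightarrow> rl_le C z x \<and> rl_le C z y"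
    if "x \<in> carrier C" "y \<in> carrier C" "z \<in> carrier C"
    using that C.meet_greatest[of z x y] C.meet_le1[of x y] C.meet_le2[of x y]
      C.meet_closed[of x y] C.le_trans[of z "rl_meet C x y"] by blast
  consider "x \<in> carrier B" "y \<in> carrier B" | "x \<in> carrier C" "y \<in> carrier C"
    | "x \<in> P" "y \<in> Q" | "x \<in> Q" "y \<in> P"
    using assms filter_sub by (auto simp: carrier_sum)
  then show ?thesis
  proof cases
    case 1
    show ?thesis
    proof (cases "z \<in> carrier B")
      case True
      then show ?thesis using 1 meet_B by (simp add: sum_B B.meet_closed)
    next
      case False
      then have "z \<in> Q" using assms filter_sub by (auto simp: carrier_sum)
      \<comment> \<open>For z in Q, lying below an element of \<open>B\<close> means that this
        element is in F, and a meet is in F exactly if both arguments are.\<close>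
      then show ?thesis
        using 1 B.meet_closed B.meet_filter B.meet_nonfilter[of x y] by (auto simp: sum_B Q_le_iff)
    qed
  next
    case 2
    show ?thesis
    proof (cases "z \<in> carrier C")
      case True
      then show ?thesis using 2 meet_C by (simp add: sum_C C.meet_closed)
    next
      case False
      then have "z \<in> P" using assms filter_sub by (auto simp: carrier_sum)
      then show ?thesis using 2 P_le_C by (simp add: sum_C C.meet_closed)
    qed
  next
    case 3
    then show ?thesis using assms sum_le_trans[of z x y] by (auto simp: sum_PQ)
  next
    case 4
    then show ?thesis using assms sum_le_trans[of z y x] by (auto simp: sum_PQ sum_QP)
  qed
qed

text \<open>If x, y in P have their \<open>B\<close>-join in F, their common upper bounds in the sum
  are exactly the elements of \<open>C\<close>: all of \<open>C\<close> lies above P, and no element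
  of P bounds both. Hence 0_C is the supremum. In all other cases the join is inherited or the
  arguments are comparable.\<close>

lemma sum_join:
  assumes "x \<in> carrier D" "y \<in> carrier D" "z \<in> carrier D"
  shows "rl_le D (rl_join D x y) z \<longleftrightarrow> rl_le D x z \<and> rl_le D y z"
proof -
  have join_B: "rl_le B (rl_join B x y) z \<longleftrightarrow> rl_le B x z \<and> rl_le B y z"
    if "x \<in> carrier B" "y \<in> carrier B" "z \<in> carrier B"
    using that B.join_least[of x z y] B.join_ge1[of x y] B.join_ge2[of x y]
      B.join_closed[of x y] B.le_trans[of _ "rl_join B x y" z] by blast
  have join_C: "rl_le C (rl_join C x y) z \<longleftrightarrow> rl_le C x z \<and> rl_le C y z"
    if "x \<in> carrier C" "y \<in> carrier C" "z \<in> carrier C"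
    using that C.join_least[of x z y] C.join_ge1[of x y] C.join_ge2[of x y]
      C.join_closed[of x y] C.le_trans[of _ "rl_join C x y" z] by blast
  consider (filter) "x \<in> P" "y \<in> P" "rl_join B x y \<in> F"
    | (P) "x \<in> P" "y \<in> P" "rl_join B x y \<in> P"
    | (PF) "x \<in> P" "y \<in> F" | (FP) "x \<in> F" "y \<in> P"
    | (C) "x \<in> carrier C" "y \<in> carrier C"
    | (PQ) "x \<in> P" "y \<in> Q" | (QP) "x \<in> Q" "y \<in> P"
    using assms B.join_closed filter_sub by (auto simp: carrier_sum)
  then show ?thesis
  proof cases
    case filter
    have J: "rl_join D x y = bottom_elem C"
      using filter by (simp add: sum_B)
    note min = bottom_elem_min[OF filter]
    show ?thesis
    proof (cases "z \<in> carrier C")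
      case True
      then show ?thesis using filter min P_le_C by (simp add: J sum_C)
    next
      case False
      then have z: "z \<in> P" using assms filter_sub by (auto simp: carrier_sum)
      then have "\<not> rl_le D (bottom_elem C) z"
        using min both_carriers by (auto simp: le_P_iff carrier_sum)
      moreover have "\<not> (rl_le B x z \<and> rl_le B y z)"
        using z filter join_B B.filter_not_le by auto
      ultimately show ?thesis using filter z by (simp add: J sum_B)
    qed
  next
    case P
    then have J: "rl_join D x y = rl_join B x y" by (simp add: sum_B)
    show ?thesis
    proof (cases "z \<in> P")
      case True
      then show ?thesis using P join_B by (simp add: J sum_B)
    next
      case False
      then have "z \<in> carrier C" using assms filter_sub by (auto simp: carrier_sum)
      then show ?thesis using P P_le_C J by simp
    qed
  next
    case PF
    then have xy: "rl_le D x y" using P_le_C filter_sub by simp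
    have "rl_join B x y = y"
      using PF B.le_iff_join[of x y] B.nonfilter_le_filter filter_sub by simp
    then have "rl_join D x y = y" using PF filter_sub by (simp add: sum_B)
    then show ?thesis using xy assms sum_le_trans[of x y z] by auto
  next
    case FP
    then have yx: "rl_le D y x" using P_le_C filter_sub by simp
    have "rl_join B x y = x"
      using FP B.le_iff_join[of y x] B.nonfilter_le_filter filter_sub B.join_commute by simp
    then have "rl_join D x y = x" using FP filter_sub by (simp add: sum_B)
    then show ?thesis using yx assms sum_le_trans[of y x z] by auto
  next
    case C
    show ?thesis
    proof (cases "z \<in> carrier C")
      case True
      then show ?thesis using C join_C by (simp add: sum_C C.join_closed)
    next
      case False
      then have "z \<in> P" using assms filter_sub by (auto simp: carrier_sum)
      then show ?thesis
        using C C.join_closed both_carriers by (auto simp: sum_C le_P_iff carrier_sum)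
    qed
  next
    case PQ
    then show ?thesis using assms sum_le_trans[of x y z] by (auto simp: sum_PQ)
  next
    case QP
    then show ?thesis using assms sum_le_trans[of y x z] by (auto simp: sum_PQ sum_QP)
  qed
qed

lemma sum_join_closed:
  assumes "x \<in> carrier D" "y \<in> carrier D"
  shows "rl_join D x y \<in> carrier D"
  using assms bottom_elem_min[of x y] unfolding carrier_sum
  by (elim carrier_cases)
    (auto simp: sum_B sum_C sum_PQ sum_QP filter_sub B.join_closed C.join_closed)

section \<open>Residuation in the sum\<close>

lemma sum_residuation_left:
  assumes "x \<in> carrier D" "y \<in> carrier D" "z \<in> carrier D"
  shows "rl_le D (x \<otimes>\<^bsub>D\<^esub> y) z \<longleftrightarrow> rl_le D y (ldiv D x z)"
proof -
  \<comment> \<open>Triples inside one algebra are inherited. \<open>PQB\<close> and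
    \<open>QPP\<close> carry the content, via the descriptions of \<sigma> and \<gamma> by
    \<open>ldiv B\<close>. In \<open>CCP\<close> and \<open>FQP\<close> both inequalities fail; in
    \<open>PDQ\<close> and \<open>CPC\<close> both hold.\<close>
  consider (B) "x \<in> carrier B" "y \<in> carrier B" "z \<in> carrier B"
    | (C) "x \<in> carrier C" "y \<in> carrier C" "z \<in> carrier C"
    | (PQB) "x \<in> P" "y \<in> Q" "z \<in> carrier B"
    | (QPP) "x \<in> Q" "y \<in> P" "z \<in> P"
    | (CCP) "x \<in> Q" "y \<in> carrier C" "z \<in> P"
    | (FQP) "x \<in> F" "y \<in> Q" "z \<in> P"
    | (PDQ) "x \<in> P" "z \<in> Q"
    | (CPC) "x \<in> carrier C" "y \<in> P" "z \<in> carrier C"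
    using assms filter_sub by (auto simp: carrier_sum)
  then show ?thesis
  proof cases
    case B
    then show ?thesis by (simp add: sum_B B.ldiv_closed B.residuation_left)
  next
    case C
    then show ?thesis by (simp add: sum_C C.ldiv_closed C.residuation_left)
  next
    case PQB
    then show ?thesis
      using P_sigma[of x] by (simp add: sum_PQ sum_B Q_le_iff B.ldiv_closed B.sigma_le_iff)
  next
    case QPP
    then show ?thesis
      using P_sigma[of y] P_gamma[of z]
      by (simp add: sum_QP sum_B B.sigma_le_iff B.le_gamma_iff)
  next
    case CCP
    then have "x \<otimes>\<^bsub>D\<^esub> y \<in> Q" using Q_mult by (simp add: sum_C)
    then show ?thesis
      using CCP P_gamma[of z] both_carriers by (auto simp: sum_QP le_P_iff carrier_sum)
  next
    case FQP
    then have "x \<otimes>\<^bsub>D\<^esub> y \<in> Q" using Q_mult filter_sub by (simp add: sum_C)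
    \<comment> \<open>With x in F, a quotient in F would force z into F by detachment.\<close>
    moreover have "ldiv B x z \<notin> F" using FQP B.ldiv_filter_D by auto
    ultimately show ?thesis
      using FQP filter_sub by (simp add: sum_B Q_le_iff B.ldiv_closed)
  next
    case PDQ
    then have "x \<otimes>\<^bsub>D\<^esub> y \<in> P"
      using assms P_sum_mult by blast
    moreover have "rl_le D y \<one>\<^bsub>B\<^esub>"
      using assms sum_le_one by blast
    ultimately show ?thesis using PDQ P_le_C by (simp add: sum_PQ)
  next
    case CPC
    then have "x \<otimes>\<^bsub>D\<^esub> y \<in> P"
      using assms P_sum_mult by blast
    then show ?thesis using CPC P_le_C by (simp add: sum_C C.ldiv_closed)
  qed
qed

lemma sum_residuation_right:
  assumes "x \<in> carrier D" "y \<in> carrier D" "z \<in> carrier D"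
  shows "rl_le D (x \<otimes>\<^bsub>D\<^esub> y) z \<longleftrightarrow> rl_le D x (rdiv D z y)"
proof -
  \<comment> \<open>The mirror image, except that \<sigma> and \<gamma> are still described by
    \<open>ldiv B\<close>: \<open>QPB\<close> has to pass between z/y and \<open>ldiv B y z\<close>,
    while \<open>PQP\<close> directly combines the two descriptions.\<close>
  consider (B) "x \<in> carrier B" "y \<in> carrier B" "z \<in> carrier B"
    | (C) "x \<in> carrier C" "y \<in> carrier C" "z \<in> carrier C"
    | (QPB) "x \<in> Q" "y \<in> P" "z \<in> carrier B"
    | (PQP) "x \<in> P" "y \<in> Q" "z \<in> P"
    | (CCP) "x \<in> carrier C" "y \<in> Q" "z \<in> P"
    | (QFP) "x \<in> Q" "y \<in> F" "z \<in> P"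
    | (DPQ) "y \<in> P" "z \<in> Q"
    | (PCC) "x \<in> P" "y \<in> carrier C" "z \<in> carrier C"
    using assms filter_sub by (auto simp: carrier_sum)
  then show ?thesis
  proof cases
    case B
    then show ?thesis by (simp add: sum_B B.rdiv_closed B.residuation_right)
  next
    case C
    then show ?thesis by (simp add: sum_C C.rdiv_closed C.residuation_right)
  next
    case QPB
    then show ?thesis
      using P_sigma[of y]
      by (simp add: sum_QP sum_B Q_le_iff B.rdiv_closed B.sigma_le_iff
          B.ldiv_filter_iff_rdiv_filter)
  next
    case PQP
    then show ?thesis
      using P_sigma[of x] P_gamma[of z]
      by (simp add: sum_PQ sum_B B.sigma_le_iff B.le_gamma_iff)
  next
    case CCP
    then have "x \<otimes>\<^bsub>D\<^esub> y \<in> Q" using Q_mult by (simp add: sum_C)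
    then show ?thesis
      using CCP P_gamma[of z] both_carriers by (auto simp: sum_PQ le_P_iff carrier_sum)
  next
    case QFP
    then have "x \<otimes>\<^bsub>D\<^esub> y \<in> Q" using Q_mult filter_sub by (simp add: sum_C)
    moreover have "rdiv B z y \<notin> F" using QFP B.rdiv_filter_D by auto
    ultimately show ?thesis
      using QFP filter_sub by (simp add: sum_B Q_le_iff B.rdiv_closed)
  next
    case DPQ
    then have "x \<otimes>\<^bsub>D\<^esub> y \<in> P"
      using assms P_sum_mult by blast
    moreover have "rl_le D x \<one>\<^bsub>B\<^esub>"
      using assms sum_le_one by blast
    ultimately show ?thesis using DPQ P_le_C by (simp add: sum_QP)
  next
    case PCC
    then have "x \<otimes>\<^bsub>D\<^esub> y \<in> P"
      using assms P_sum_mult by blast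
    then show ?thesis using PCC P_le_C by (simp add: sum_C C.rdiv_closed)
  qed
qed

section \<open>The sum as the unique gluing\<close>

theorem sum_irl: "integral_residuated_lattice D"
proof (rule integral_residuated_latticeI)
  fix x y assume xy: "x \<in> carrier D" "y \<in> carrier D"
  show "rl_meet D x y \<in> carrier D" "ldiv D x y \<in> carrier D" "rdiv D x y \<in> carrier D"
    using xy P_gamma unfolding carrier_sum
    by (elim carrier_cases;
        auto simp: sum_B sum_C sum_PQ sum_QP filter_sub B.meet_closed C.meet_closed
          B.ldiv_closed C.ldiv_closed B.rdiv_closed C.rdiv_closed)+
  show "rl_le D x x"
    using xy B.le_refl C.le_refl by (auto simp: carrier_sum sum_B sum_C)
  show "rl_le D x \<one>\<^bsub>D\<^esub>"
    using xy sum_le_one by (simp add: one_sum)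
  show "x = y" if "rl_le D x y" "rl_le D y x"
    using that xy[unfolded carrier_sum] B.le_antisym C.le_antisym
    by (elim carrier_cases) (auto simp: sum_B sum_C sum_PQ sum_QP filter_sub)
qed (fact sum_monoid sum_join_closed sum_meet sum_join sum_residuation_left
    sum_residuation_right sum_le_trans)+

theorem sum_is_gluing: "is_gluing B C F D"
  unfolding is_gluing_def
proof (intro conjI ballI)
  show "congruence_filter D F"
    unfolding congruence_filter_def
  proof (intro conjI ballI impI)
    show "F \<noteq> {}" using B.one_filter by blast
    show "F \<subseteq> carrier D" using filter_sub by (auto simp: carrier_sum)
    fix x assume x: "x \<in> F"
    \<comment> \<open>An element of F lies in both algebras, so every clause takes place inside
      \<open>B\<close> or inside \<open>C\<close> and no mixed operation occurs.\<close>
    note xBC = filter_sub[OF x]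
    {
      fix y assume "y \<in> carrier D" "rl_le D x y"
      then show "y \<in> F"
        using x xBC B.filter_upward C.filter_upward by (auto simp: carrier_sum sum_B sum_C)
    }
    {
      fix y assume y: "y \<in> F"
      then show "x \<otimes>\<^bsub>D\<^esub> y \<in> F"
        using x filter_sub B.filter_mult by (simp add: sum_B)
    }
    fix y assume "y \<in> carrier D"
    then show "rdiv D (y \<otimes>\<^bsub>D\<^esub> x) y \<in> F" "ldiv D y (x \<otimes>\<^bsub>D\<^esub> y) \<in> F"
      using x xBC B.filter_conj_left B.filter_conj_right C.filter_conj_left C.filter_conj_right
      by (auto simp: carrier_sum sum_B sum_C)
  qed
  show "rl_less D b c" if "b \<in> P" "c \<in> Q" for b c
    using that both_carriers by (auto simp: rl_less_def sum_PQ)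
  show "rl_less D c f" if "c \<in> Q" "f \<in> F" for c f
    using that filter_sub C.nonfilter_le_filter by (auto simp: rl_less_def sum_C)
  show "agree_on (carrier C) C D"
    using one_eq one_sum
    by (simp add: agree_on_def agree_except_join_on_def agree_join_on_def sum_C)
  show "agree_except_join_on (carrier B) B D"
    using one_sum by (simp add: agree_except_join_on_def sum_B)
  show "agree_join_on (carrier B) B D \<or> (\<exists>m. is_min D F m)"
  proof (cases "\<exists>x\<in>P. \<exists>y\<in>P. rl_join B x y \<in> F")
    case True
    then obtain x y where xy: "x \<in> P" "y \<in> P" "rl_join B x y \<in> F" by blast
    \<comment> \<open>Each f in F bounds x and y, hence also their \<open>B\<close>-join. So
      whenever the join of \<open>B\<close> is altered, its former value is the bottom of F.\<close>
    have "rl_le D (rl_join B x y) f" if "f \<in> F" for f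
      using xy that filter_sub B.join_least B.nonfilter_le_filter B.join_closed
      by (simp add: sum_B)
    then show ?thesis using xy by (auto simp: is_min_def)
  next
    case False
    then show ?thesis by (auto simp: agree_join_on_def sum_B)
  qed
qed (use sum_irl carrier_sum inter in auto)

text \<open>Uniqueness takes the form of agreement on the common carrier because the operations are
  total functions, with arbitrary values outside it.\<close>

theorem gluing_unique:
  assumes "is_gluing B C F E"
  shows "agree_on (carrier B \<union> carrier C) E D"
proof -
  interpret E: integral_residuated_lattice E
    using assms by (simp add: is_gluing_def)
  have carE: "carrier E = carrier B \<union> carrier C"
    using assms by (simp add: is_gluing_def)
  have E_B: "x \<otimes>\<^bsub>E\<^esub> y = x \<otimes>\<^bsub>B\<^esub> y" "rl_meet E x y = rl_meet B x y"
    "ldiv E x y = ldiv B x y" "rdiv E x y = rdiv B x y"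
    if "x \<in> carrier B" "y \<in> carrier B" for x y
    using assms that by (simp_all add: is_gluing_def agree_except_join_on_def)
  have E_C: "x \<otimes>\<^bsub>E\<^esub> y = x \<otimes>\<^bsub>C\<^esub> y" "rl_meet E x y = rl_meet C x y"
    if "x \<in> carrier C" "y \<in> carrier C" for x y
    using assms that by (simp_all add: is_gluing_def agree_on_def agree_except_join_on_def)
  have one: "\<one>\<^bsub>E\<^esub> = \<one>\<^bsub>D\<^esub>"
    using assms by (simp add: is_gluing_def agree_except_join_on_def gluing_sum_def)
  have less: "rl_less E b c" "rl_less E c f" if "b \<in> P" "c \<in> Q" "f \<in> F" for b c f
    using assms that by (auto simp: is_gluing_def)
  \<comment> \<open>The two strict inequalities come bundled over all f in F; the unit serves as
    f.\<close>
  have PQ: "rl_meet E b c = b" if "b \<in> P" "c \<in> Q" for b c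
    using less(1)[OF that B.one_filter] by (simp add: rl_less_def rl_le_def)
  have meet: "rl_meet E x y = rl_meet D x y"
    if "x \<in> carrier B \<union> carrier C" "y \<in> carrier B \<union> carrier C" for x y
    using that PQ PQ[of y x] E.meet_commute[of x y]
    by (elim carrier_cases) (auto simp: carE E_B E_C sum_B sum_C sum_PQ sum_QP filter_sub)
  have le: "rl_le E x y \<longleftrightarrow> rl_le D x y"
    if "x \<in> carrier B \<union> carrier C" "y \<in> carrier B \<union> carrier C" for x y
    using that meet by (simp add: rl_le_def)
  have mixed: "b \<otimes>\<^bsub>E\<^esub> c = sigma B F b" "c \<otimes>\<^bsub>E\<^esub> b = sigma B F b" if b: "b \<in> P" and c: "c \<in> Q" for b c
  proof -
    \<comment> \<open>By integrality of \<open>E\<close> both mixed products lie below b, so this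
      places them in P.\<close>
    have below: "y \<in> P" if "y \<in> carrier E" "rl_le E y b" for y
      using that b le le_P_iff by (simp add: carE carrier_sum)
    have cF: "rl_le E c w \<longleftrightarrow> w \<in> F" if "w \<in> carrier B" for w
      using that c le Q_le_iff by simp
    have s: "sigma B F b \<in> P" using b P_sigma by blast
    have bc: "b \<otimes>\<^bsub>E\<^esub> c \<in> P" "c \<otimes>\<^bsub>E\<^esub> b \<in> P"
    proof -
      have "b \<in> carrier E" "c \<in> carrier E" using b c by (auto simp: carE)
      then show "b \<otimes>\<^bsub>E\<^esub> c \<in> P" "c \<otimes>\<^bsub>E\<^esub> b \<in> P"
        using below E.mult_le1 E.mult_le2 E.m_closed by blast+
    qed
    have leB: "rl_le E x y \<longleftrightarrow> rl_le B x y" if "x \<in> P" "y \<in> P" for x y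
      using that le by (simp add: sum_B)
    \<comment> \<open>Residuation in \<open>E\<close> puts c below a quotient of elements of
      \<open>B\<close>, where \<open>E\<close> agrees with \<open>B\<close>; that inequality holds
      exactly if the quotient is in F.\<close>
    have iff: "rl_le E (b \<otimes>\<^bsub>E\<^esub> c) y \<longleftrightarrow> rl_le E (sigma B F b) y"
      "rl_le E (c \<otimes>\<^bsub>E\<^esub> b) y \<longleftrightarrow> rl_le E (sigma B F b) y" if y: "y \<in> P" for y
    proof -
      have "rl_le E (b \<otimes>\<^bsub>E\<^esub> c) y \<longleftrightarrow> ldiv B b y \<in> F"
        using b c y cF by (simp add: E.residuation_left carE E_B B.ldiv_closed)
      moreover have "rl_le E (c \<otimes>\<^bsub>E\<^esub> b) y \<longleftrightarrow> rdiv B y b \<in> F"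
        using b c y cF by (simp add: E.residuation_right carE E_B B.rdiv_closed)
      moreover have "rl_le E (sigma B F b) y \<longleftrightarrow> ldiv B b y \<in> F"
        using b s y by (simp add: leB B.sigma_le_iff)
      ultimately show "rl_le E (b \<otimes>\<^bsub>E\<^esub> c) y \<longleftrightarrow> rl_le E (sigma B F b) y"
        "rl_le E (c \<otimes>\<^bsub>E\<^esub> b) y \<longleftrightarrow> rl_le E (sigma B F b) y"
        using b y B.ldiv_filter_iff_rdiv_filter by auto
    qed
    \<comment> \<open>The products and \<sigma>(b) all lie in P, so y can be taken to be either side
      of each equation.\<close>
    have "P \<subseteq> carrier E" by (auto simp: carE)
    then show "b \<otimes>\<^bsub>E\<^esub> c = sigma B F b" "c \<otimes>\<^bsub>E\<^esub> b = sigma B F b"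
      using iff bc s E.le_refl E.le_antisym by (meson subsetD)+
  qed
  show ?thesis
  proof (rule agree_on_if_meet_mult_agree)
    show "x \<otimes>\<^bsub>E\<^esub> y = x \<otimes>\<^bsub>D\<^esub> y"
      if "x \<in> carrier B \<union> carrier C" "y \<in> carrier B \<union> carrier C" for x y
      using that
      by (elim carrier_cases) (auto simp: E_B E_C mixed sum_B sum_C sum_PQ sum_QP filter_sub)
  qed (use sum_irl carE carrier_sum one meet E.integral_residuated_lattice_axioms in auto)
qed

end

text \<open>The third conjunct gives the definite article in "the gluing" its content.\<close>

theorem theorem2p8:
  fixes B C :: "'a reslat" and F :: "'a set"
  assumes "integral_residuated_lattice B"
    and "integral_residuated_lattice C"
    and "carrier B \<inter> carrier C = F"
    and "agree_on F B C"
    and "congruence_filter C F"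
    and "\<forall>f\<in>F. \<forall>c\<in>carrier C - F. rl_less C c f"
    and "congruence_filter B F"
    and "compatible B F"
    and "(\<exists>x\<in>carrier B - F. \<exists>y\<in>carrier B - F. rl_join B x y \<in> F)
           \<longrightarrow> (\<exists>m. is_min C (carrier C) m)"
  shows "integral_residuated_lattice (gluing_sum B F C)
    \<and> is_gluing B C F (gluing_sum B F C)
    \<and> (\<forall>D. is_gluing B C F D \<longrightarrow> agree_on (carrier B \<union> carrier C) D (gluing_sum B F C))"
proof -
  interpret B: integral_residuated_lattice B by fact
  interpret C: integral_residuated_lattice C by fact
  interpret gluing_pair B C F
    using assms by unfold_locales auto
  show ?thesis
    using sum_irl sum_is_gluing gluing_unique by blast
qed

end
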